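(* Let $\Omega\subset\mathbb R^2$ be a compact set with simple closed, piecewise continuously differentiable boundary $\partial\Omega$. If $\partial\Omega$ is tangent-cone graph-like (TCGL) with radius $r$, then for each $\epsilon\in(0,r)$ there exists a polygonal approximation to $\partial\Omega$ (a closed polygonal curve) that is TCGL with radius $r-\epsilon$ and such that every point on $\partial\Omega$ is within distance $\frac{\epsilon}{6}$ of the polygon.
   Context: $\gamma:[0,L]\to\partial\Omega$ is a continuous counterclockwise arclength parameterization, $\gamma(0)=\gamma(L)$; $D(p,r)$ is the closed disk of radius $r$ about $p$. The tangent cone of a piecewise $C^1$ closed curve $\gamma$ at $s$ is $T_\gamma(s)=\{\alpha\Gamma^-+\beta\Gamma^+:\alpha,\beta\ge0,\alpha+\beta>0\}$, where $\Gamma^-=\lim_{t\uparrow s}\gamma'(t)$, $\Gamma^+=\lim_{t\downarrow s}\gamma'(t)$ (extended periodically). The curve is TCGL with radius $r$ at $p=\gamma(s)$ if for every $w\in T_\gamma(s)$ and every pair of distinct points $u,v$ of the curve lying in $D(p,r)$, $\langle w,u-v\rangle\neq0$; it is TCGL with radius $r$ if this holds at each of its points. The same definitions apply to the polygon with its own arclength parameterization. *)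

theory Defs
  imports "HOL-Complex_Analysis.Complex_Analysis" "HOL-Library.Real_Mod"
begin

text \<open>
  A curve is a function on the reals of which only the values on \<open>{0..L}\<close> matter.
\<close>

definition subdivision :: "nat \<Rightarrow> (nat \<Rightarrow> real) \<Rightarrow> real \<Rightarrow> bool" where
  "subdivision n t L \<longleftrightarrow> t 0 = 0 \<and> t n = L \<and> (\<forall>i<n. t i < t (Suc i))"

text \<open>
  The derivative is one-sided at the end points and continuous up to them, so that the one-sided
  limits of the derivative exist everywhere.  The library notion
  \<^const>\<open>piecewise_C1_differentiable_on\<close> does not guarantee this.
\<close>

definition C1_on_interval :: "(real \<Rightarrow> 'a::real_normed_vector) \<Rightarrow> real \<Rightarrow> real \<Rightarrow> bool" where
  "C1_on_interval \<gamma> a b \<longleftrightarrow>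
     (\<exists>D. continuous_on {a..b} D \<and>
          (\<forall>s\<in>{a..b}. (\<gamma> has_vector_derivative D s) (at s within {a..b})))"

definition piecewise_C1 :: "(real \<Rightarrow> 'a::real_normed_vector) \<Rightarrow> real \<Rightarrow> bool" where
  "piecewise_C1 \<gamma> L \<longleftrightarrow>
     continuous_on {0..L} \<gamma> \<and>
     (\<exists>n t. subdivision n t L \<and> (\<forall>i<n. C1_on_interval \<gamma> (t i) (t (Suc i))))"

definition polygonal :: "(real \<Rightarrow> 'a::real_normed_vector) \<Rightarrow> real \<Rightarrow> bool" where
  "polygonal \<gamma> L \<longleftrightarrow>
     (\<exists>n t. subdivision n t L \<and>
        (\<forall>i<n. \<forall>s\<in>{t i..t (Suc i)}.
           \<gamma> s = linepath (\<gamma> (t i)) (\<gamma> (t (Suc i))) ((s - t i) / (t (Suc i) - t i))))"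

text \<open>
  The length of the restriction of \<open>\<gamma>\<close> to \<open>{0..s}\<close>, i.e. the integral of the speed, is \<open>s\<close>.
  The finitely many points where a piecewise continuously differentiable \<open>\<gamma>\<close> has no
  derivative do not affect the integral.
\<close>

definition arclength_parameterized :: "(real \<Rightarrow> 'a::real_normed_vector) \<Rightarrow> real \<Rightarrow> bool" where
  "arclength_parameterized \<gamma> L \<longleftrightarrow>
     (\<forall>s\<in>{0..L}. ((\<lambda>t. norm (vector_derivative \<gamma> (at t))) has_integral s) {0..s})"

definition closed_curve :: "(real \<Rightarrow> 'a) \<Rightarrow> real \<Rightarrow> bool" where
  "closed_curve \<gamma> L \<longleftrightarrow> L > 0 \<and> \<gamma> L = \<gamma> 0"

definition simple_closed_curve :: "(real \<Rightarrow> 'a) \<Rightarrow> real \<Rightarrow> bool" where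
  "simple_closed_curve \<gamma> L \<longleftrightarrow> closed_curve \<gamma> L \<and> inj_on \<gamma> {0..<L}"

definition to_complex :: "real ^ 2 \<Rightarrow> complex" where
  "to_complex x = Complex (x $ 1) (x $ 2)"

definition counterclockwise :: "(real \<Rightarrow> real ^ 2) \<Rightarrow> real \<Rightarrow> bool" where
  "counterclockwise \<gamma> L \<longleftrightarrow>
     (\<forall>z\<in>inside (\<gamma> ` {0..L}). winding_number (\<lambda>t. to_complex (\<gamma> (L * t))) (to_complex z) = 1)"

definition boundary_parameterization ::
    "(real ^ 2) set \<Rightarrow> (real \<Rightarrow> real ^ 2) \<Rightarrow> real \<Rightarrow> bool" where
  "boundary_parameterization \<Omega> \<gamma> L \<longleftrightarrow>
     simple_closed_curve \<gamma> L \<and> \<gamma> ` {0..L} = frontier \<Omega> \<and> piecewise_C1 \<gamma> L \<and>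
     arclength_parameterized \<gamma> L \<and> counterclockwise \<gamma> L"

definition periodic_extension :: "(real \<Rightarrow> 'a) \<Rightarrow> real \<Rightarrow> real \<Rightarrow> 'a" where
  "periodic_extension \<gamma> L s = \<gamma> (s rmod L)"

definition left_tangent :: "(real \<Rightarrow> 'a::real_normed_vector) \<Rightarrow> real \<Rightarrow> real \<Rightarrow> 'a" where
  "left_tangent \<gamma> L s =
     Lim (at_left s) (\<lambda>t. vector_derivative (periodic_extension \<gamma> L) (at t))"

definition right_tangent :: "(real \<Rightarrow> 'a::real_normed_vector) \<Rightarrow> real \<Rightarrow> real \<Rightarrow> 'a" where
  "right_tangent \<gamma> L s =
     Lim (at_right s) (\<lambda>t. vector_derivative (periodic_extension \<gamma> L) (at t))"

definition tangent_cone :: "(real \<Rightarrow> 'a::real_normed_vector) \<Rightarrow> real \<Rightarrow> real \<Rightarrow> 'a set" where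
  "tangent_cone \<gamma> L s =
     {\<alpha> *\<^sub>R left_tangent \<gamma> L s + \<beta> *\<^sub>R right_tangent \<gamma> L s | \<alpha> \<beta>.
        \<alpha> \<ge> 0 \<and> \<beta> \<ge> 0 \<and> \<alpha> + \<beta> > 0}"

definition TCGL_at :: "(real \<Rightarrow> 'a::real_inner) \<Rightarrow> real \<Rightarrow> real \<Rightarrow> real \<Rightarrow> bool" where
  "TCGL_at \<gamma> L r s \<longleftrightarrow>
     (\<forall>w\<in>tangent_cone \<gamma> L s.
        \<forall>u\<in>\<gamma> ` {0..L} \<inter> cball (\<gamma> s) r. \<forall>v\<in>\<gamma> ` {0..L} \<inter> cball (\<gamma> s) r.
          u \<noteq> v \<longrightarrow> w \<bullet> (u - v) \<noteq> 0)"

definition TCGL :: "(real \<Rightarrow> 'a::real_inner) \<Rightarrow> real \<Rightarrow> real \<Rightarrow> bool" where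
  "TCGL \<gamma> L r \<longleftrightarrow> (\<forall>s\<in>{0..L}. TCGL_at \<gamma> L r s)"

end

theory Submission
  imports Defs
begin

text \<open>
  The polygon is inscribed in the curve with a fine uniform mesh.  By a planar mean value theorem,
  every direction in the tangent cone of the polygon, also at a vertex, is parallel to a direction
  \<open>c\<close> in the tangent cone of the curve at a nearby point.  There the functional \<open>c \<bullet> _\<close> is injective
  on the part of the curve in a disk of radius \<open>r\<close>, and by the intermediate value theorem its value
  at a point of an edge is attained on the arc cut off by that edge.  So two points of the polygon
  with equal values come from one and the same arc or from a common end point of two arcs, and
  hence agree.
\<close>

section \<open>One-sided tangents of periodic curves\<close>

text \<open>Half-open pieces leave room on one side of \<open>s\<close>: this version serves left
  tangents, \<open>piece_right_closed\<close> serves right tangents.\<close>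

lemma piece_left_closed:
  fixes t :: "nat \<Rightarrow> 'a::linorder"
  assumes "t 0 < s" "s \<le> t n"
  shows "\<exists>i<n. t i < s \<and> s \<le> t (Suc i)"
  using assms
proof (induction n)
  case (Suc n)
  then show ?case by (cases "s \<le> t n") (auto intro: less_SucI)
qed auto

lemma piece_right_closed:
  fixes t :: "nat \<Rightarrow> 'a::linorder"
  assumes "t 0 \<le> s" "s < t n"
  shows "\<exists>i<n. t i \<le> s \<and> s < t (Suc i)"
  using assms
proof (induction n)
  case (Suc n)
  then show ?case by (cases "s < t n") (auto intro: less_SucI)
qed auto

lemma subdivision_mono:
  assumes "subdivision n t L" "i \<le> j" "j \<le> n"
  shows "t i \<le> t j"
  using assms(2,3)
proof (induction j rule: dec_induct)
  case (step m)
  then show ?case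
    using assms(1) by (force simp: subdivision_def Suc_le_eq intro: order_trans[of _ "t m"])
qed simp

lemma subdivision_in_range:
  assumes "subdivision n t L" "i \<le> n"
  shows "0 \<le> t i" "t i \<le> L"
  using subdivision_mono[OF assms(1), of 0 i] subdivision_mono[OF assms(1), of i n] assms
  by (auto simp: subdivision_def)

section \<open>The periodic extension and reduction to one period\<close>

lemma periodic_extension_shift:
  "periodic_extension \<gamma> L (x + of_int k * L) = periodic_extension \<gamma> L x"
proof -
  have "(x + of_int k * L) rmod L = x rmod L"
    using rmod_add[of x L "of_int k * L"] by simp
  then show ?thesis by (simp add: periodic_extension_def)
qed

lemma periodic_extension_eq:
  assumes "closed_curve \<gamma> L" "x \<in> {0..L}"
  shows "periodic_extension \<gamma> L x = \<gamma> x"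
  using assms by (cases "x = L") (auto simp: periodic_extension_def closed_curve_def)

lemma shift_into_period_left_closed:
  fixes s L :: real
  assumes "0 < L"
  obtains k :: int where "s + of_int k * L \<in> {0..<L}"
proof
  have "s - L * of_int \<lfloor>s / L\<rfloor> = s rmod L" using assms by (simp add: rmod_def)
  then show "s + of_int (- \<lfloor>s / L\<rfloor>) * L \<in> {0..<L}"
    using rmod_nonneg[of L s] rmod_less[of L s] assms by (simp add: mult.commute)
qed

lemma shift_into_period_right_closed:
  fixes s L :: real
  assumes "0 < L"
  obtains k :: int where "s + of_int k * L \<in> {0<..L}"
proof -
  \<comment> \<open>Reflecting \<open>s\<close> turns the left-closed period into a right-closed
    one.\<close>
  obtain k :: int where "- s + of_int k * L \<in> {0..<L}"
    using shift_into_period_left_closed[OF assms] .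
  then have "s + of_int (1 - k) * L \<in> {0<..L}" by (auto simp: algebra_simps)
  then show ?thesis by (rule that)
qed

lemma range_periodic_extension:
  assumes "closed_curve \<gamma> L"
  shows "range (periodic_extension \<gamma> L) = \<gamma> ` {0..L}"
proof
  have L: "0 < L" using assms by (simp add: closed_curve_def)
  show "range (periodic_extension \<gamma> L) \<subseteq> \<gamma> ` {0..L}"
  proof clarify
    fix x
    show "periodic_extension \<gamma> L x \<in> \<gamma> ` {0..L}"
      using rmod_nonneg[of L x] rmod_le[of L x] L by (auto simp: periodic_extension_def)
  qed
  show "\<gamma> ` {0..L} \<subseteq> range (periodic_extension \<gamma> L)"
    using periodic_extension_eq[OF assms] by (metis (no_types) image_subsetI rangeI)
qed

lemma periodic_extension_eq_iff:
  assumes "simple_closed_curve \<gamma> L"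
  shows "periodic_extension \<gamma> L x = periodic_extension \<gamma> L y \<longleftrightarrow> (\<exists>k::int. x = y + of_int k * L)"
proof
  have L: "0 < L" and inj: "inj_on \<gamma> {0..<L}"
    using assms by (auto simp: simple_closed_curve_def closed_curve_def)
  assume "periodic_extension \<gamma> L x = periodic_extension \<gamma> L y"
  moreover have "z rmod L \<in> {0..<L}" for z
    using rmod_nonneg[of L z] rmod_less[of L z] L by auto
  ultimately have "x rmod L = y rmod L"
    using inj by (auto simp: periodic_extension_def inj_on_def)
  then have "x = y + of_int (\<lfloor>x / L\<rfloor> - \<lfloor>y / L\<rfloor>) * L"
    using L by (auto simp: rmod_def algebra_simps)
  then show "\<exists>k::int. x = y + of_int k * L" ..
qed (auto simp: periodic_extension_shift)

section \<open>Invariance of derivatives and tangents under translation by periods\<close>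

lemma has_vector_derivative_shift_periodic:
  assumes "\<And>x. f (x + d) = f x"
  shows "(f has_vector_derivative D) (at (x + d) within (\<lambda>x. x + d) ` S) \<longleftrightarrow>
    (f has_vector_derivative D) (at x within S)"
proof -
  have *: "(f has_vector_derivative D) (at x within S)"
    if "(f has_vector_derivative D) (at (x + d) within (\<lambda>x. x + d) ` S)"
      and "\<And>x. f (x + d) = f x" for d x :: real and S
  proof -
    have "((\<lambda>x. x + d) has_vector_derivative 1) (at x within S)"
      by (auto intro!: derivative_eq_intros)
    from vector_diff_chain_within[OF this that(1)]
    show ?thesis by (simp add: o_def that(2))
  qed
  show ?thesis
  proof
    \<comment> \<open>The converse is the same implication for the shift \<open>- d\<close>, based
      at \<open>x + d\<close>.\<close>
    assume "(f has_vector_derivative D) (at x within S)"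
    moreover have "f (x + - d) = f x" for x
      using assms[of "x - d"] by simp
    ultimately show "(f has_vector_derivative D) (at (x + d) within (\<lambda>x. x + d) ` S)"
      using *[of "x + d" "- d" "(\<lambda>x. x + d) ` S"] by (simp add: image_image)
  qed (use * assms in blast)
qed

lemma image_add_lessThan_right: "(\<lambda>x. x + d) ` {..<s} = {..<s + d :: real}"
  by (force intro: image_eqI[of x _ "x - d" for x])

lemma image_add_greaterThan_right: "(\<lambda>x. x + d) ` {s<..} = {s + d :: real<..}"
  by (force intro: image_eqI[of x _ "x - d" for x])

lemma filtermap_add_at_left: "filtermap (\<lambda>x. x + d) (at_left s) = at_left (s + d :: real)"
  using filtermap_nhds_shift[of "- d" s, symmetric]
  by (simp add: filter_eq_iff eventually_filtermap eventually_at_filter)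

lemma filtermap_add_at_right: "filtermap (\<lambda>x. x + d) (at_right s) = at_right (s + d :: real)"
  using filtermap_at_right_shift[of "- d" s] by simp

lemma Lim_filtermap: "Lim (filtermap g F) f = Lim F (\<lambda>x. f (g x))"
  unfolding Topological_Spaces.Lim_def filterlim_def filtermap_filtermap ..

lemma vector_derivative_periodic_extension_shift:
  "vector_derivative (periodic_extension \<gamma> L) (at (x + of_int k * L)) =
   vector_derivative (periodic_extension \<gamma> L) (at x)"
proof -
  have "surj (\<lambda>x. x + of_int k * L)" by (intro surjI[of _ "\<lambda>x. x - of_int k * L"]) simp
  then show ?thesis
    using has_vector_derivative_shift_periodic[of "periodic_extension \<gamma> L" "of_int k * L" _ x UNIV]
    by (simp add: vector_derivative_def periodic_extension_shift)
qed

text \<open>Moving the translation from the filter into the function makes both sides the same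
  \<open>Lim\<close> term, whether or not the limit exists.\<close>

lemma left_tangent_shift: "left_tangent \<gamma> L (s + of_int k * L) = left_tangent \<gamma> L s"
  unfolding left_tangent_def filtermap_add_at_left[symmetric] Lim_filtermap
  by (simp add: vector_derivative_periodic_extension_shift)

lemma right_tangent_shift: "right_tangent \<gamma> L (s + of_int k * L) = right_tangent \<gamma> L s"
  unfolding right_tangent_def filtermap_add_at_right[symmetric] Lim_filtermap
  by (simp add: vector_derivative_periodic_extension_shift)

section \<open>Existence of one-sided tangents\<close>

lemma vector_derivative_on_piece:
  assumes "closed_curve \<gamma> L" "0 \<le> a" "b \<le> L" "s \<in> {a<..<b}"
    and "(\<gamma> has_vector_derivative D) (at s within {a..b})"
  shows "vector_derivative (periodic_extension \<gamma> L) (at s) = D"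
proof -
  have "(\<gamma> has_vector_derivative D) (at s)"
    using assms(4,5) by (auto simp: at_within_Icc_at)
  then have "(periodic_extension \<gamma> L has_vector_derivative D) (at s)"
    by (rule has_vector_derivative_transform_within_open[where S = "{a<..<b}"])
      (use assms(2-4) periodic_extension_eq[OF assms(1)] in auto)
  then show ?thesis by (rule vector_derivative_at)
qed

text \<open>To the left of \<open>s\<close> the derivative of the extension is \<open>D\<close>, so
  its limit is \<open>D s\<close> by continuity. The second claim identifies this limit of
  derivatives with the left derivative at \<open>s\<close> itself, which is what arguments about
  extrema use.\<close>

lemma left_tangent_on_piece:
  assumes "closed_curve \<gamma> L" "0 \<le> a" "b \<le> L" "continuous_on {a..b} D"
    and D: "\<And>s. s \<in> {a..b} \<Longrightarrow> (\<gamma> has_vector_derivative D s) (at s within {a..b})"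
    and s: "a < s" "s \<le> b"
  shows "left_tangent \<gamma> L s = D s"
    and "(periodic_extension \<gamma> L has_vector_derivative D s) (at_left s)"
proof -
  have "(D \<longlongrightarrow> D s) (at s within {a..b})"
    using assms(4) s by (auto simp: continuous_on)
  then have "(D \<longlongrightarrow> D s) (at s within {a..s})"
    by (rule tendsto_within_subset) (use s in auto)
  then have lim: "(D \<longlongrightarrow> D s) (at_left s)"
    using s(1) by (simp add: at_within_Icc_at_left)
  have "\<forall>\<^sub>F t in at_left s. t \<in> {a<..<s}"
    using eventually_at_left_field s(1) by auto
  then have "\<forall>\<^sub>F t in at_left s. D t = vector_derivative (periodic_extension \<gamma> L) (at t)"
    by eventually_elim
      (use s vector_derivative_on_piece[OF assms(1-3) _ D] in auto)
  then have "((\<lambda>t. vector_derivative (periodic_extension \<gamma> L) (at t)) \<longlongrightarrow> D s) (at_left s)"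
    by (rule Lim_transform_eventually[OF lim])
  then show "left_tangent \<gamma> L s = D s"
    unfolding left_tangent_def by (intro tendsto_Lim) auto
  have "(periodic_extension \<gamma> L has_vector_derivative D s) (at s within {a..b})"
    using has_vector_derivative_transform[OF _ _ D[of s], of "periodic_extension \<gamma> L"]
      periodic_extension_eq[OF assms(1)] assms(2,3) s by auto
  then have "(periodic_extension \<gamma> L has_vector_derivative D s) (at s within {a..s})"
    by (rule has_vector_derivative_within_subset) (use s in auto)
  then show "(periodic_extension \<gamma> L has_vector_derivative D s) (at_left s)"
    using s(1) by (simp add: at_within_Icc_at_left)
qed

lemma right_tangent_on_piece:
  assumes "closed_curve \<gamma> L" "0 \<le> a" "b \<le> L" "continuous_on {a..b} D"
    and D: "\<And>s. s \<in> {a..b} \<Longrightarrow> (\<gamma> has_vector_derivative D s) (at s within {a..b})"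
    and s: "a \<le> s" "s < b"
  shows "right_tangent \<gamma> L s = D s"
    and "(periodic_extension \<gamma> L has_vector_derivative D s) (at_right s)"
proof -
  have "(D \<longlongrightarrow> D s) (at s within {a..b})"
    using assms(4) s by (auto simp: continuous_on)
  then have "(D \<longlongrightarrow> D s) (at s within {s..b})"
    by (rule tendsto_within_subset) (use s in auto)
  then have lim: "(D \<longlongrightarrow> D s) (at_right s)"
    using s(2) by (simp add: at_within_Icc_at_right)
  have "\<forall>\<^sub>F t in at_right s. t \<in> {s<..<b}"
    using eventually_at_right_field s(2) by auto
  then have "\<forall>\<^sub>F t in at_right s. D t = vector_derivative (periodic_extension \<gamma> L) (at t)"
    by eventually_elim
      (use s vector_derivative_on_piece[OF assms(1-3) _ D] in auto)
  then have "((\<lambda>t. vector_derivative (periodic_extension \<gamma> L) (at t)) \<longlongrightarrow> D s) (at_right s)"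
    by (rule Lim_transform_eventually[OF lim])
  then show "right_tangent \<gamma> L s = D s"
    unfolding right_tangent_def by (intro tendsto_Lim) auto
  have "(periodic_extension \<gamma> L has_vector_derivative D s) (at s within {a..b})"
    using has_vector_derivative_transform[OF _ _ D[of s], of "periodic_extension \<gamma> L"]
      periodic_extension_eq[OF assms(1)] assms(2,3) s by auto
  then have "(periodic_extension \<gamma> L has_vector_derivative D s) (at s within {s..b})"
    by (rule has_vector_derivative_within_subset) (use s in auto)
  then show "(periodic_extension \<gamma> L has_vector_derivative D s) (at_right s)"
    using s(2) by (simp add: at_within_Icc_at_right)
qed

text \<open>A translate of \<open>s\<close> lies in \<open>{0<..L}\<close>, hence has a piece to its
  left; periodicity carries the result back. At \<open>s = 0\<close> this reads off the end of the
  last piece.\<close>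

lemma has_left_tangent:
  assumes "closed_curve \<gamma> L" "piecewise_C1 \<gamma> L"
  shows "(periodic_extension \<gamma> L has_vector_derivative left_tangent \<gamma> L s) (at_left s)"
proof -
  obtain n t where sub: "subdivision n t L"
    and C1: "\<And>i. i < n \<Longrightarrow> C1_on_interval \<gamma> (t i) (t (Suc i))"
    using assms(2) by (auto simp: piecewise_C1_def)
  have *: "(periodic_extension \<gamma> L has_vector_derivative left_tangent \<gamma> L s) (at_left s)"
    if s: "s \<in> {0<..L}" for s
  proof -
    obtain i where i: "i < n" "t i < s" "s \<le> t (Suc i)"
      using piece_left_closed[of t s n] sub s by (auto simp: subdivision_def)
    obtain D where D: "continuous_on {t i..t (Suc i)} D"
      "\<And>s. s \<in> {t i..t (Suc i)} \<Longrightarrow>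
        (\<gamma> has_vector_derivative D s) (at s within {t i..t (Suc i)})"
      using C1[OF i(1)] by (auto simp: C1_on_interval_def)
    have "0 \<le> t i" "t (Suc i) \<le> L"
      using subdivision_in_range[OF sub] i(1) by auto
    from left_tangent_on_piece[OF assms(1) this D i(2,3)] show ?thesis by simp
  qed
  obtain k :: int where k: "s + of_int k * L \<in> {0<..L}"
    using assms(1) shift_into_period_right_closed unfolding closed_curve_def by metis
  from *[OF k] show ?thesis
    using has_vector_derivative_shift_periodic[of "periodic_extension \<gamma> L" "of_int k * L" _ s "{..<s}"]
    by (simp add: left_tangent_shift periodic_extension_shift image_add_lessThan_right)
qed

lemma has_right_tangent:
  assumes "closed_curve \<gamma> L" "piecewise_C1 \<gamma> L"
  shows "(periodic_extension \<gamma> L has_vector_derivative right_tangent \<gamma> L s) (at_right s)"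
proof -
  obtain n t where sub: "subdivision n t L"
    and C1: "\<And>i. i < n \<Longrightarrow> C1_on_interval \<gamma> (t i) (t (Suc i))"
    using assms(2) by (auto simp: piecewise_C1_def)
  have *: "(periodic_extension \<gamma> L has_vector_derivative right_tangent \<gamma> L s) (at_right s)"
    if s: "s \<in> {0..<L}" for s
  proof -
    obtain i where i: "i < n" "t i \<le> s" "s < t (Suc i)"
      using piece_right_closed[of t s n] sub s by (auto simp: subdivision_def)
    obtain D where D: "continuous_on {t i..t (Suc i)} D"
      "\<And>s. s \<in> {t i..t (Suc i)} \<Longrightarrow>
        (\<gamma> has_vector_derivative D s) (at s within {t i..t (Suc i)})"
      using C1[OF i(1)] by (auto simp: C1_on_interval_def)
    have "0 \<le> t i" "t (Suc i) \<le> L"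
      using subdivision_in_range[OF sub] i(1) by auto
    from right_tangent_on_piece[OF assms(1) this D i(2,3)] show ?thesis by simp
  qed
  obtain k :: int where k: "s + of_int k * L \<in> {0..<L}"
    using assms(1) shift_into_period_left_closed unfolding closed_curve_def by metis
  from *[OF k] show ?thesis
    using has_vector_derivative_shift_periodic[of "periodic_extension \<gamma> L" "of_int k * L" _ s "{s<..}"]
    by (simp add: right_tangent_shift periodic_extension_shift image_add_greaterThan_right)
qed

lemma continuous_on_periodic_extension:
  assumes "closed_curve \<gamma> L" "piecewise_C1 \<gamma> L"
  shows "continuous_on S (periodic_extension \<gamma> L)"
  using has_left_tangent[OF assms] has_right_tangent[OF assms]
  by (intro continuous_at_imp_continuous_on)
    (auto simp: continuous_at_split dest: has_vector_derivative_continuous)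

lemma uniformly_continuous_periodic_extension:
  fixes \<gamma> :: "real \<Rightarrow> 'a::real_normed_vector"
  assumes "closed_curve \<gamma> L" "piecewise_C1 \<gamma> L" "0 < \<eta>"
  obtains \<delta> where "0 < \<delta>"
    "\<And>x y. \<bar>x - y\<bar> < \<delta> \<Longrightarrow> dist (periodic_extension \<gamma> L x) (periodic_extension \<gamma> L y) < \<eta>"
proof -
  have L: "0 < L" using assms(1) by (simp add: closed_curve_def)
  have "uniformly_continuous_on {- L..2 * L} (periodic_extension \<gamma> L)"
    by (intro compact_uniformly_continuous continuous_on_periodic_extension assms) simp
  then obtain d where d: "0 < d"
    "\<And>x y. x \<in> {- L..2 * L} \<Longrightarrow> y \<in> {- L..2 * L} \<Longrightarrow> dist y x < d \<Longrightarrow>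
      dist (periodic_extension \<gamma> L y) (periodic_extension \<gamma> L x) < \<eta>"
    unfolding uniformly_continuous_on_def using assms(3) by metis
  show ?thesis
  proof
    \<comment> \<open>After \<open>x\<close> is shifted into \<open>{0..<L}\<close>, a distance
      below \<open>L\<close> keeps the shifted \<open>y\<close> inside \<open>{- L..2 * L}\<close>,
      where uniform continuity is known.\<close>
    show "0 < min d L" using d(1) L by simp
    fix x y :: real
    assume xy: "\<bar>x - y\<bar> < min d L"
    obtain k :: int where k: "x + of_int k * L \<in> {0..<L}"
      using shift_into_period_left_closed[OF L] .
    have "dist (periodic_extension \<gamma> L (x + of_int k * L))
      (periodic_extension \<gamma> L (y + of_int k * L)) < \<eta>"
      by (rule d(2)) (use k xy in \<open>auto simp: dist_real_def\<close>)
    then show "dist (periodic_extension \<gamma> L x) (periodic_extension \<gamma> L y) < \<eta>"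
      by (simp add: periodic_extension_shift)
  qed
qed

section \<open>Closed polygons\<close>

definition vertex_time :: "(nat \<Rightarrow> 'a::metric_space) \<Rightarrow> nat \<Rightarrow> real" where
  "vertex_time V i = (\<Sum>j<i. dist (V j) (V (Suc j)))"

text \<open>Each edge contributes its unit direction times the time already spent on it, clamped
  between 0 and the edge length. This gives unit speed without choosing the edge that contains
  \<open>s\<close>.\<close>

definition polygon_path :: "(nat \<Rightarrow> 'a::real_normed_vector) \<Rightarrow> nat \<Rightarrow> real \<Rightarrow> 'a" where
  "polygon_path V N s = V 0 +
     (\<Sum>j<N. max 0 (min (dist (V j) (V (Suc j))) (s - vertex_time V j)) *\<^sub>R sgn (V (Suc j) - V j))"

lemma vertex_time_0 [simp]: "vertex_time V 0 = 0"
  by (simp add: vertex_time_def)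

lemma vertex_time_Suc: "vertex_time V (Suc i) = vertex_time V i + dist (V i) (V (Suc i))"
  by (simp add: vertex_time_def)

lemma vertex_time_mono: "i \<le> j \<Longrightarrow> vertex_time V i \<le> vertex_time V j"
  by (simp add: vertex_time_def sum_mono2)

lemma dist_scaleR_sgn: "dist x y *\<^sub>R sgn (y - x) = y - (x :: 'a::real_normed_vector)"
  by (cases "x = y") (simp_all add: dist_norm sgn_div_norm norm_minus_commute)

text \<open>Edges before \<open>i\<close> contribute their full vectors, which telescope to
  \<open>V i - V 0\<close>; edges after \<open>i\<close> contribute nothing.\<close>

lemma polygon_path_on_edge:
  assumes "i < N" "s \<in> {vertex_time V i..vertex_time V (Suc i)}"
  shows "polygon_path V N s = V i + (s - vertex_time V i) *\<^sub>R sgn (V (Suc i) - V i)"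
proof -
  define c where
    "c j = max 0 (min (dist (V j) (V (Suc j))) (s - vertex_time V j)) *\<^sub>R sgn (V (Suc j) - V j)" for j
  have before: "c j = V (Suc j) - V j" if "j < i" for j
  proof -
    have "dist (V j) (V (Suc j)) \<le> s - vertex_time V j"
      using vertex_time_mono[of "Suc j" i V] that assms(2) by (simp add: vertex_time_Suc)
    then show ?thesis by (simp add: c_def min_absorb1 max_absorb2 dist_scaleR_sgn)
  qed
  have after: "c j = 0" if "i < j" for j
  proof -
    have "s - vertex_time V j \<le> 0"
      using vertex_time_mono[of "Suc i" j V] that assms(2) by simp
    then show ?thesis by (simp add: c_def max_absorb1 min.coboundedI2)
  qed
  have "c i = (s - vertex_time V i) *\<^sub>R sgn (V (Suc i) - V i)"
    using assms(2) by (simp add: c_def vertex_time_Suc min_absorb2 max_absorb2)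
  moreover have "sum c {..<N} = sum c {..<Suc i}"
    by (rule sum.mono_neutral_right) (use after assms(1) in auto)
  moreover have "sum c {..<i} = V i - V 0"
    using sum_lessThan_telescope[of V i] before by simp
  ultimately show ?thesis
    by (simp add: polygon_path_def c_def)
qed

text \<open>The vertices form a periodic sequence on all of \<open>nat\<close>, so the edge
  following the last one needs no special index. Distinct neighbours make every edge direction a
  unit vector.\<close>

locale closed_polygon =
  fixes V :: "nat \<Rightarrow> 'a::real_normed_vector" and N :: nat
  assumes N_pos: "0 < N"
    and V_periodic: "V (i + N) = V i"
    and V_neq: "V i \<noteq> V (Suc i)"
begin

abbreviation "P \<equiv> polygon_path V N"
abbreviation "T \<equiv> vertex_time V"
abbreviation "edge_direction i \<equiv> sgn (V (Suc i) - V i)"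

lemma T_less_Suc: "T i < T (Suc i)"
  using V_neq[of i] by (simp add: vertex_time_Suc)

lemma T_nonneg: "0 \<le> T i"
  using vertex_time_mono[of 0 i V] by simp

lemma subdivision_T: "subdivision N T (T N)"
  using T_less_Suc by (simp add: subdivision_def)

lemma P_vertex: "i \<le> N \<Longrightarrow> P (T i) = V i"
proof (cases i)
  case 0
  then show ?thesis
    using polygon_path_on_edge[of 0 N 0 V] N_pos by (simp add: vertex_time_Suc)
next
  case (Suc j)
  assume "i \<le> N"
  then show ?thesis
    using polygon_path_on_edge[of j N "T i" V] Suc
    by (simp add: vertex_time_Suc dist_scaleR_sgn)
qed

lemma edge_of_left_closed:
  assumes "s \<in> {0<..T N}"
  obtains i where "i < N" "T i < s" "s \<le> T (Suc i)"
  using piece_left_closed[of T s N] assms by auto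

lemma P_on_edge_linepath:
  assumes "i < N" "s \<in> {T i..T (Suc i)}"
  shows "P s = linepath (V i) (V (Suc i)) ((s - T i) / (T (Suc i) - T i))"
proof -
  have "(s - T i) *\<^sub>R edge_direction i =
    ((s - T i) / dist (V i) (V (Suc i))) *\<^sub>R dist (V i) (V (Suc i)) *\<^sub>R edge_direction i"
    using V_neq[of i] by simp
  then show ?thesis
    unfolding polygon_path_on_edge[OF assms] linepath_def vertex_time_Suc dist_scaleR_sgn
    by (simp add: algebra_simps)
qed

lemma P_on_edge_segment:
  assumes "i < N" "s \<in> {T i..T (Suc i)}"
  shows "P s \<in> closed_segment (V i) (V (Suc i))"
proof -
  have "(s - T i) / (T (Suc i) - T i) \<in> {0..1}"
    using assms(2) T_less_Suc[of i] by (simp add: field_simps)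
  then show ?thesis
    unfolding P_on_edge_linepath[OF assms] by (simp add: linepath_in_path)
qed

lemma closed_curve_P: "closed_curve P (T N)"
  using T_less_Suc[of 0] vertex_time_mono[of "Suc 0" N V] N_pos P_vertex[of N] P_vertex[of 0]
    V_periodic[of 0]
  by (simp add: closed_curve_def)

lemma polygonal_P: "polygonal P (T N)"
  unfolding polygonal_def
proof (intro exI conjI allI impI ballI)
  show "subdivision N T (T N)" by (rule subdivision_T)
next
  fix i s
  assume "i < N" "s \<in> {T i..T (Suc i)}"
  then show "P s = linepath (P (T i)) (P (T (Suc i))) ((s - T i) / (T (Suc i) - T i))"
    using P_on_edge_linepath[of i s] P_vertex[of i] P_vertex[of "Suc i"] by simp
qed

lemma P_has_derivative:
  assumes "i < N" "s \<in> {T i..T (Suc i)}"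
  shows "(P has_vector_derivative edge_direction i) (at s within {T i..T (Suc i)})"
  by (rule has_vector_derivative_transform[OF assms(2) polygon_path_on_edge[OF assms(1)]])
    (auto intro!: derivative_eq_intros)

lemma arclength_parameterized_P: "arclength_parameterized P (T N)"
  unfolding arclength_parameterized_def
proof
  fix s
  assume s: "s \<in> {0..T N}"
  have unit_speed: "norm (vector_derivative P (at t)) = 1" if t: "t \<in> {0..s} - T ` {..N}" for t
  proof -
    have "t \<noteq> T 0" using t by blast
    then have "t \<in> {0<..T N}" using t s by auto
    then obtain i where i: "i < N" "T i < t" "t \<le> T (Suc i)"
      using edge_of_left_closed by blast
    moreover have "t \<noteq> T (Suc i)" using t i(1) by auto
    ultimately have "(P has_vector_derivative edge_direction i) (at t)"
      using P_has_derivative[of i t] by (simp add: at_within_Icc_at)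
    then show ?thesis using V_neq[of i] by (simp add: vector_derivative_at norm_sgn)
  qed
  \<comment> \<open>The speed is 1 except possibly at the finitely many vertex times, which do not
    change the integral.\<close>
  have "((\<lambda>_. 1) has_integral s) {0..s}"
    using has_integral_const_real[of "1::real" 0 s] s by simp
  then show "((\<lambda>t. norm (vector_derivative P (at t))) has_integral s) {0..s}"
    by (rule has_integral_spike_finite[where S = "T ` {..N}", rotated 2]) (simp_all add: unit_speed)
qed

lemma image_P_subset: "P ` {0..T N} \<subseteq> (\<Union>i<N. closed_segment (V i) (V (Suc i)))"
proof clarify
  fix s
  assume s: "s \<in> {0..T N}"
  show "P s \<in> (\<Union>i<N. closed_segment (V i) (V (Suc i)))"
  proof (cases "s = 0")
    case True
    then show ?thesis using N_pos P_vertex[of 0] by auto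
  next
    case False
    then obtain i where "i < N" "T i < s" "s \<le> T (Suc i)"
      using edge_of_left_closed[of s] s by (auto simp: le_less)
    then show ?thesis using P_on_edge_segment[of i s] by auto
  qed
qed

lemma vertex_in_image: "i \<le> N \<Longrightarrow> V i \<in> P ` {0..T N}"
  using P_vertex[of i] T_nonneg[of i] vertex_time_mono[of i N V] by (auto intro: image_eqI[of _ _ "T i"])

section \<open>Tangent cones of a polygon\<close>

lemma left_tangent_P:
  assumes "i < N" "T i < s" "s \<le> T (Suc i)"
  shows "left_tangent P (T N) s = edge_direction i"
  by (rule left_tangent_on_piece(1)[OF closed_curve_P, where D = "\<lambda>_. edge_direction i"])
    (use assms P_has_derivative T_nonneg vertex_time_mono[of "Suc i" N V] in auto)

lemma right_tangent_P:
  assumes "i < N" "T i \<le> s" "s < T (Suc i)"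
  shows "right_tangent P (T N) s = edge_direction i"
  by (rule right_tangent_on_piece(1)[OF closed_curve_P, where D = "\<lambda>_. edge_direction i"])
    (use assms P_has_derivative T_nonneg vertex_time_mono[of "Suc i" N V] in auto)

lemma right_tangent_vertex:
  assumes "i \<le> N"
  shows "right_tangent P (T N) (T i) = edge_direction i"
proof (cases "i = N")
  case True
  \<comment> \<open>At the closing vertex the outgoing edge is the first one, which periodicity of
    \<open>V\<close> names edge \<open>N\<close>.\<close>
  have "right_tangent P (T N) (T N) = right_tangent P (T N) 0"
    using right_tangent_shift[of P "T N" 0 1] by simp
  also have "\<dots> = edge_direction 0"
    using right_tangent_P[of 0 0] N_pos T_less_Suc[of 0] by simp
  also have "\<dots> = edge_direction N"
    using V_periodic[of 0] V_periodic[of 1] by simp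
  finally show ?thesis using True by simp
qed (use assms right_tangent_P T_less_Suc in auto)

text \<open>At the end of edge \<open>i\<close> the two tangents are the directions of edges
  \<open>i\<close> and \<open>Suc i\<close>. Elsewhere on the edge both are the direction of edge
  \<open>i\<close>, so \<open>\<alpha> + \<beta>\<close> goes to the first coefficient and 0 to the
  second.\<close>

lemma tangent_cone_P_pos:
  assumes s: "s \<in> {0<..T N}" and w: "w \<in> tangent_cone P (T N) s"
  obtains i \<alpha> \<beta> where "i < N" "P s \<in> closed_segment (V i) (V (Suc i))"
    "0 \<le> \<alpha>" "0 \<le> \<beta>" "0 < \<alpha> + \<beta>" "w = \<alpha> *\<^sub>R edge_direction i + \<beta> *\<^sub>R edge_direction (Suc i)"
proof -
  obtain i where i: "i < N" "T i < s" "s \<le> T (Suc i)"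
    using edge_of_left_closed s by blast
  obtain \<alpha> \<beta> where ab: "0 \<le> \<alpha>" "0 \<le> \<beta>" "0 < \<alpha> + \<beta>"
    "w = \<alpha> *\<^sub>R edge_direction i + \<beta> *\<^sub>R right_tangent P (T N) s"
    using w left_tangent_P[OF i] by (auto simp: tangent_cone_def)
  have seg: "P s \<in> closed_segment (V i) (V (Suc i))"
    using P_on_edge_segment i by simp
  show ?thesis
  proof (cases "s = T (Suc i)")
    case True
    then show ?thesis
      using that[OF i(1) seg ab(1-3)] ab(4) right_tangent_vertex[of "Suc i"] i(1) by simp
  next
    case False
    then have "w = (\<alpha> + \<beta>) *\<^sub>R edge_direction i + 0 *\<^sub>R edge_direction (Suc i)"
      using ab(4) right_tangent_P[of i s] i by (simp add: scaleR_add_left)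
    then show ?thesis using that[OF i(1) seg, of "\<alpha> + \<beta>" 0] ab by simp
  qed
qed

lemma tangent_cone_P:
  assumes s: "s \<in> {0..T N}" and w: "w \<in> tangent_cone P (T N) s"
  obtains i \<alpha> \<beta> where "i < N" "P s \<in> closed_segment (V i) (V (Suc i))"
    "0 \<le> \<alpha>" "0 \<le> \<beta>" "0 < \<alpha> + \<beta>"
    "w = \<alpha> *\<^sub>R (V (Suc i) - V i) + \<beta> *\<^sub>R (V (Suc (Suc i)) - V (Suc i))"
proof -
  obtain s' where s': "s' \<in> {0<..T N}" "w \<in> tangent_cone P (T N) s'" "P s' = P s"
  proof (cases "s = 0")
    case True
    \<comment> \<open>The starting point is treated as the end of the last edge.\<close>
    have "tangent_cone P (T N) (T N) = tangent_cone P (T N) 0"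
      using right_tangent_shift[of P "T N" 0 1] left_tangent_shift[of P "T N" 0 1]
      by (simp add: tangent_cone_def)
    moreover have "T N \<in> {0<..T N}" "P (T N) = P 0"
      using closed_curve_P by (auto simp: closed_curve_def)
    ultimately show ?thesis using that[of "T N"] w True by simp
  next
    case False
    then show ?thesis using that[of s] w s by simp
  qed
  obtain i \<alpha> \<beta> where i: "i < N" "P s' \<in> closed_segment (V i) (V (Suc i))"
    "0 \<le> \<alpha>" "0 \<le> \<beta>" "0 < \<alpha> + \<beta>" "w = \<alpha> *\<^sub>R edge_direction i + \<beta> *\<^sub>R edge_direction (Suc i)"
    using tangent_cone_P_pos[OF s'(1,2)] .
  \<comment> \<open>Dividing the coefficients by the edge lengths replaces unit directions by edge
    vectors and preserves the sign conditions.\<close>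
  define d where "d j = norm (V (Suc j) - V j)" for j
  have d: "0 < d j" for j using V_neq[of j] by (simp add: d_def)
  have "0 < \<alpha> / d i + \<beta> / d (Suc i)"
    using i(3-5) d by (cases "\<alpha> = 0") (auto intro!: add_pos_nonneg divide_pos_pos divide_nonneg_pos)
  moreover have "w = (\<alpha> / d i) *\<^sub>R (V (Suc i) - V i) +
    (\<beta> / d (Suc i)) *\<^sub>R (V (Suc (Suc i)) - V (Suc i))"
    using i(6) by (simp add: sgn_div_norm d_def divide_inverse)
  ultimately show ?thesis
    using that[of i "\<alpha> / d i" "\<beta> / d (Suc i)"] i s'(3) d by (simp add: less_imp_le)
qed

end

section \<open>Extrema and tangent cones\<close>

text \<open>The sign condition says that \<open>f c\<close> is at least both end values or at most
  both. An extremum attained at an end point is then attained at \<open>c\<close> as well.\<close>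

lemma interior_extremum:
  fixes f :: "real \<Rightarrow> real"
  assumes "continuous_on {a..b} f" "a < c" "c < b" "(f c - f a) * (f b - f c) \<le> 0"
  shows "\<exists>s\<in>{a<..<b}. (\<forall>x\<in>{a..b}. f x \<le> f s) \<or> (\<forall>x\<in>{a..b}. f s \<le> f x)"
proof -
  have *: "\<exists>s\<in>{a<..<b}. \<forall>x\<in>{a..b}. g x \<le> g s"
    if g: "continuous_on {a..b} g" "g a \<le> g c" "g b \<le> g c" for g :: "real \<Rightarrow> real"
  proof -
    obtain s where s: "s \<in> {a..b}" "\<And>x. x \<in> {a..b} \<Longrightarrow> g x \<le> g s"
      using continuous_attains_sup[of "{a..b}" g] g(1) assms(2,3) by fastforce
    show ?thesis
    proof (cases "s = a \<or> s = b")
      case True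
      then have "\<forall>x\<in>{a..b}. g x \<le> g c" using s(2) g(2,3) by force
      then show ?thesis using assms(2,3) by (intro bexI[of _ c]) auto
    qed (use s in \<open>force simp: le_less\<close>)
  qed
  have "f a \<le> f c \<and> f b \<le> f c \<or> - f a \<le> - f c \<and> - f b \<le> - f c"
    using assms(4) by (auto simp: mult_le_0_iff)
  then consider "f a \<le> f c" "f b \<le> f c" | "- f a \<le> - f c" "- f b \<le> - f c" by blast
  then show ?thesis
  proof cases
    case 1
    then show ?thesis using *[OF assms(1)] by blast
  next
    case 2
    then show ?thesis using *[OF continuous_on_minus[OF assms(1)]] by auto
  qed
qed

lemma one_sided_derivatives_at_max:
  fixes f :: "real \<Rightarrow> real"
  assumes l: "(f has_real_derivative l) (at_left s)" and r: "(f has_real_derivative r) (at_right s)"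
    and s: "s \<in> {a<..<b}" and max: "\<And>x. x \<in> {a..b} \<Longrightarrow> f x \<le> f s"
  shows "0 \<le> l" "r \<le> 0"
proof -
  show "0 \<le> l"
  proof (rule ccontr)
    assume "\<not> 0 \<le> l"
    then obtain d where d: "0 < d" "\<And>h. 0 < h \<Longrightarrow> h < d \<Longrightarrow> f s < f (s - h)"
      using has_real_derivative_neg_dec_left[OF l] by auto
    \<comment> \<open>Small enough for the strict comparison and for \<open>s - h\<close> to stay in
      \<open>{a..b}\<close>.\<close>
    define h where "h = min (d / 2) (s - a)"
    have "0 < h" "h < d" "s - h \<in> {a..b}" using d(1) s by (auto simp: h_def min_def)
    then show False using d(2)[of h] max[of "s - h"] by simp
  qed
  show "r \<le> 0"
  proof (rule ccontr)
    assume "\<not> r \<le> 0"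
    then obtain d where d: "0 < d" "\<And>h. 0 < h \<Longrightarrow> h < d \<Longrightarrow> f s < f (s + h)"
      using has_real_derivative_pos_inc_right[OF r] by auto
    define h where "h = min (d / 2) (b - s)"
    have "0 < h" "h < d" "s + h \<in> {a..b}" using d(1) s by (auto simp: h_def min_def)
    then show False using d(2)[of h] max[of "s + h"] by simp
  qed
qed

lemma one_sided_derivatives_at_extremum:
  fixes f :: "real \<Rightarrow> real"
  assumes "(f has_real_derivative l) (at_left s)" "(f has_real_derivative r) (at_right s)"
    and "s \<in> {a<..<b}" "(\<forall>x\<in>{a..b}. f x \<le> f s) \<or> (\<forall>x\<in>{a..b}. f s \<le> f x)"
  shows "l * r \<le> 0"
  using assms(4)
proof
  assume "\<forall>x\<in>{a..b}. f x \<le> f s"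
  then show ?thesis
    using one_sided_derivatives_at_max[OF assms(1-3)] by (simp add: mult_nonneg_nonpos)
next
  assume "\<forall>x\<in>{a..b}. f s \<le> f x"
  then show ?thesis
    using one_sided_derivatives_at_max[OF DERIV_minus[OF assms(1)] DERIV_minus[OF assms(2)] assms(3)]
    by (simp add: mult_nonpos_nonneg)
qed

text \<open>The counterclockwise quarter turn; \<open>perp w \<bullet> x\<close> is the determinant
  with columns \<open>w\<close> and \<open>x\<close>.\<close>

definition perp :: "real ^ 2 \<Rightarrow> real ^ 2" where
  "perp w = vector [- (w $ 2), w $ 1]"

lemma inner_perp: "perp w \<bullet> x = w $ 1 * x $ 2 - w $ 2 * x $ 1"
  by (simp add: perp_def inner_vec_def sum_2)

lemma perp_orthogonal_imp_parallel:
  assumes "w \<noteq> 0" "perp w \<bullet> c = 0"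
  obtains k where "c = k *\<^sub>R w"
proof (cases "w $ 1 = 0")
  case True
  then have "w $ 2 \<noteq> 0" using assms(1) by (auto simp: vec_eq_iff forall_2)
  then have "c = (c $ 2 / w $ 2) *\<^sub>R w"
    using True assms(2) by (auto simp: vec_eq_iff forall_2 inner_perp)
  then show ?thesis by (rule that)
next
  case False
  then have "c = (c $ 1 / w $ 1) *\<^sub>R w"
    using assms(2) by (auto simp: vec_eq_iff forall_2 inner_perp field_simps)
  then show ?thesis by (rule that)
qed

lemma tangent_cone_shift: "tangent_cone \<gamma> L (s + of_int k * L) = tangent_cone \<gamma> L s"
  by (simp add: tangent_cone_def left_tangent_shift right_tangent_shift)

text \<open>
  At an interior extremum of \<open>n \<bullet> G x\<close> the one-sided derivatives have opposite signs, so that a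
  nonnegative combination of the two tangents is orthogonal to \<open>n\<close>.
\<close>

lemma tangent_cone_orthogonal:
  fixes \<gamma> :: "real \<Rightarrow> 'a::real_inner" and L :: real and n :: 'a
  defines "G \<equiv> periodic_extension \<gamma> L"
  assumes \<gamma>: "closed_curve \<gamma> L" "piecewise_C1 \<gamma> L"
    and "a < c" "c < b" "(n \<bullet> (G c - G a)) * (n \<bullet> (G b - G c)) \<le> 0"
  obtains s v where "s \<in> {a<..<b}" "v \<in> tangent_cone \<gamma> L s" "n \<bullet> v = 0"
proof -
  have "continuous_on {a..b} (\<lambda>x. n \<bullet> G x)"
    unfolding G_def by (intro continuous_intros continuous_on_periodic_extension \<gamma>)
  then obtain s where s: "s \<in> {a<..<b}"
    "(\<forall>x\<in>{a..b}. n \<bullet> G x \<le> n \<bullet> G s) \<or> (\<forall>x\<in>{a..b}. n \<bullet> G s \<le> n \<bullet> G x)"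
    using interior_extremum[of a b "\<lambda>x. n \<bullet> G x" c] assms(4-6) by (auto simp: inner_diff_right)
  define l r where "l = left_tangent \<gamma> L s" and "r = right_tangent \<gamma> L s"
  have "((\<lambda>x. n \<bullet> G x) has_real_derivative n \<bullet> l) (at_left s)"
    "((\<lambda>x. n \<bullet> G x) has_real_derivative n \<bullet> r) (at_right s)"
    using has_left_tangent[OF \<gamma>, of s] has_right_tangent[OF \<gamma>, of s]
    unfolding l_def r_def G_def has_real_derivative_iff_has_vector_derivative
    by (auto intro: bounded_linear.has_vector_derivative[OF bounded_linear_inner_right])
  then have "(n \<bullet> l) * (n \<bullet> r) \<le> 0"
    using one_sided_derivatives_at_extremum s by blast
  then have *: "\<bar>n \<bullet> r\<bar> * (n \<bullet> l) + \<bar>n \<bullet> l\<bar> * (n \<bullet> r) = 0"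
    by (auto simp: mult_le_0_iff abs_if)
  show ?thesis
  \<comment> \<open>If \<open>n \<bullet> l = 0\<close>, both coefficients in the balanced
    combination could vanish, which the cone excludes; then \<open>l\<close> itself is orthogonal to
    \<open>n\<close>.\<close>
  proof (cases "n \<bullet> l = 0")
    case True
    have "l = 1 *\<^sub>R l + 0 *\<^sub>R r" by simp
    then have "l \<in> tangent_cone \<gamma> L s"
      unfolding tangent_cone_def l_def r_def by fastforce
    then show ?thesis using that[OF s(1)] True by blast
  next
    case False
    then have "\<bar>n \<bullet> r\<bar> *\<^sub>R l + \<bar>n \<bullet> l\<bar> *\<^sub>R r \<in> tangent_cone \<gamma> L s"
      unfolding tangent_cone_def l_def r_def by fastforce
    moreover have "n \<bullet> (\<bar>n \<bullet> r\<bar> *\<^sub>R l + \<bar>n \<bullet> l\<bar> *\<^sub>R r) = 0"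
      using * by (simp add: inner_add_right)
    ultimately show ?thesis using that[OF s(1)] by blast
  qed
qed

text \<open>Shifting \<open>s\<close> by periods into \<open>{0..<L}\<close> changes neither its
  cone nor its point, so the TCGL condition holds at all real parameters.\<close>

lemma TCGL_periodic_extension:
  fixes \<gamma> :: "real \<Rightarrow> 'a::real_inner" and L :: real
  defines "G \<equiv> periodic_extension \<gamma> L"
  assumes "closed_curve \<gamma> L" "TCGL \<gamma> L r" "w \<in> tangent_cone \<gamma> L s"
    and "dist (G s) (G x) \<le> r" "dist (G s) (G y) \<le> r" "G x \<noteq> G y"
  shows "w \<bullet> (G x - G y) \<noteq> 0"
proof -
  obtain k :: int where k: "s + of_int k * L \<in> {0..<L}"
    using assms(2) shift_into_period_left_closed unfolding closed_curve_def by metis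
  then have "TCGL_at \<gamma> L r (s + of_int k * L)"
    using assms(3) by (auto simp: TCGL_def)
  moreover have "\<gamma> (s + of_int k * L) = G s"
    using periodic_extension_eq[OF assms(2), of "s + of_int k * L"] k
    by (simp add: G_def periodic_extension_shift)
  moreover have "G x \<in> \<gamma> ` {0..L}" "G y \<in> \<gamma> ` {0..L}"
    using range_periodic_extension[OF assms(2)] by (auto simp: G_def)
  ultimately show ?thesis
    using assms(4-7) by (auto simp: TCGL_at_def tangent_cone_shift)
qed

section \<open>Linear functionals on segments and arcs\<close>

lemma inner_inj_on_segment:
  assumes "c \<bullet> (b - a) \<noteq> 0" "u \<in> closed_segment a b" "v \<in> closed_segment a b" "c \<bullet> u = c \<bullet> v"
  shows "u = v"
proof -
  obtain x y where "u = a + x *\<^sub>R (b - a)" "v = a + y *\<^sub>R (b - a)"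
    using assms(2,3) by (auto simp: closed_segment_def algebra_simps)
  moreover from this have "x * (c \<bullet> (b - a)) = y * (c \<bullet> (b - a))"
    using assms(4) by (simp add: inner_add_right)
  ultimately show ?thesis using assms(1) by simp
qed

text \<open>The value at \<open>u\<close> lies between the values at the ends of the chord, so the
  arc attains it by the intermediate value theorem.\<close>

lemma inner_segment_attained:
  fixes f :: "real \<Rightarrow> 'a::real_inner"
  assumes "continuous_on {a..b} f" "a \<le> b" "u \<in> closed_segment (f a) (f b)"
  obtains x where "x \<in> {a..b}" "c \<bullet> f x = c \<bullet> u"
proof -
  let ?g = "\<lambda>x. c \<bullet> f x"
  have "connected (?g ` {a..b})"
    by (intro connected_continuous_image continuous_intros assms(1)) simp
  then have "convex (?g ` {a..b})"
    by (simp add: connected_convex_1)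
  then have "closed_segment (?g a) (?g b) \<subseteq> ?g ` {a..b}"
    by (intro closed_segment_subset) (use assms(2) in auto)
  moreover have "c \<bullet> u \<in> closed_segment (?g a) (?g b)"
    using assms(3) closed_segment_linear_image[of "(\<bullet>) c" "f a" "f b"]
    by (simp add: bounded_linear.linear bounded_linear_inner_right)
  ultimately show ?thesis using that by (metis (no_types, lifting) imageE subsetD)
qed

section \<open>Inscribed polygons\<close>

text \<open>\<open>\<eta>\<close> bounds the distance between curve points whose parameters differ
  by at most one mesh width. In \<open>R + 3 * \<eta>\<close>, two terms \<open>\<eta>\<close> lead
  from a curve point carrying the cone to the polygon point, \<open>R\<close> is the radius of the
  disk there, and the last \<open>\<eta>\<close> leads from an edge back to its arc. The bound
  \<open>2 * \<eta> \<le> r\<close> keeps two adjacent arcs in the disk about their common vertex,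
  and \<open>3 \<le> N\<close> keeps them from covering the whole curve.\<close>

locale TCGL_sampling =
  fixes \<gamma> :: "real \<Rightarrow> real ^ 2" and L r R \<eta> :: real and N :: nat
  assumes simple: "simple_closed_curve \<gamma> L" and C1: "piecewise_C1 \<gamma> L"
    and TCGL: "TCGL \<gamma> L r" and N: "3 \<le> N"
    and mesh: "\<bar>x - y\<bar> \<le> L / N \<Longrightarrow> dist (periodic_extension \<gamma> L x) (periodic_extension \<gamma> L y) \<le> \<eta>"
    and R: "R + 3 * \<eta> \<le> r" and \<eta>: "2 * \<eta> \<le> r"
begin

abbreviation "G \<equiv> periodic_extension \<gamma> L"

definition h :: real where "h = L / N"

definition V :: "nat \<Rightarrow> real ^ 2" where "V i = G (i * h)"

lemma closed: "closed_curve \<gamma> L"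
  using simple by (simp add: simple_closed_curve_def)

lemma h_pos: "0 < h" and two_h_less: "2 * h < L" and N_h: "N * h = L"
  using closed N by (auto simp: h_def closed_curve_def field_simps)

lemma mesh_h: "\<bar>x - y\<bar> \<le> h \<Longrightarrow> dist (G x) (G y) \<le> \<eta>"
  using mesh by (simp add: h_def)

lemma G_eq_iff: "G x = G y \<longleftrightarrow> (\<exists>k::int. x = y + of_int k * L)"
  using periodic_extension_eq_iff[OF simple] .

lemma G_neq:
  assumes "x \<noteq> y" "\<bar>x - y\<bar> < L"
  shows "G x \<noteq> G y"
proof
  assume "G x = G y"
  then obtain k :: int where k: "x = y + of_int k * L" using G_eq_iff by blast
  with assms(1) have "1 \<le> \<bar>k\<bar>" by (cases "k = 0") auto
  then have "1 * L \<le> \<bar>of_int k\<bar> * L"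
    using h_pos two_h_less by (intro mult_right_mono) linarith+
  then show False using k assms(2) h_pos two_h_less by (simp add: abs_mult)
qed

sublocale closed_polygon V N
proof
  show "0 < N" using N by simp
  show "V (i + N) = V i" for i
    using periodic_extension_shift[of \<gamma> L "i * h" 1] N_h by (simp add: V_def distrib_right)
  show "V i \<noteq> V (Suc i)" for i
    unfolding V_def using h_pos two_h_less by (intro G_neq) (auto simp: algebra_simps)
qed

text \<open>Both ends of the edge lie in the disk of radius \<open>\<eta>\<close> about
  \<open>G x\<close>, and the disk is convex.\<close>

lemma arc_near_segment:
  assumes "x \<in> {i * h..Suc i * h}" "u \<in> closed_segment (V i) (V (Suc i))"
  shows "dist (G x) u \<le> \<eta>"
proof -
  have "V i \<in> cball (G x) \<eta>" "V (Suc i) \<in> cball (G x) \<eta>"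
    unfolding V_def mem_cball by (rule mesh_h; use assms(1) h_pos in \<open>auto simp: algebra_simps\<close>)+
  then have "closed_segment (V i) (V (Suc i)) \<subseteq> cball (G x) \<eta>"
    by (intro closed_segment_subset) auto
  then show ?thesis using assms(2) by auto
qed

lemma cone_inner_neq:
  assumes "c \<in> tangent_cone \<gamma> L s" "dist (G s) (G x) \<le> r" "dist (G s) (G y) \<le> r" "G x \<noteq> G y"
  shows "c \<bullet> (G x - G y) \<noteq> 0"
  using TCGL_periodic_extension[OF closed TCGL] assms by blast

text \<open>
  On a segment a nonvanishing linear functional is injective, and its value at \<open>u\<close> is already
  attained on the corresponding arc; injectivity on the arcs therefore transfers to the segments.
\<close>

lemma cone_inner_segments_neq:
  assumes c: "c \<in> tangent_cone \<gamma> L s" and jk: "j \<le> k" "k < N"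
    and u: "u \<in> closed_segment (V j) (V (Suc j))" and v: "v \<in> closed_segment (V k) (V (Suc k))"
    and near_j: "\<And>x. x \<in> {j * h..Suc j * h} \<Longrightarrow> dist (G s) (G x) \<le> r"
    and near_k: "\<And>x. x \<in> {k * h..Suc k * h} \<Longrightarrow> dist (G s) (G x) \<le> r"
    and "u \<noteq> v"
  shows "c \<bullet> u \<noteq> c \<bullet> v"
proof
  assume eq: "c \<bullet> u = c \<bullet> v"
  \<comment> \<open>The ends of an edge are distinct curve points in the disk, so \<open>c\<close>
    is not constant along the edge.\<close>
  have edge: "c \<bullet> (V (Suc i) - V i) \<noteq> 0"
    if "\<And>x. x \<in> {i * h..Suc i * h} \<Longrightarrow> dist (G s) (G x) \<le> r" for i
    using cone_inner_neq[OF c that that, of "Suc i * h" "i * h"] V_neq[of i] h_pos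
    unfolding V_def by auto
  show False
  proof (cases "j = k")
    case True
    then show False using inner_inj_on_segment[OF edge[OF near_j] u _ eq] v \<open>u \<noteq> v\<close> by auto
  next
    case False
    have le: "i * h \<le> Suc i * h" for i using h_pos by simp
    obtain x where x: "x \<in> {j * h..Suc j * h}" "c \<bullet> G x = c \<bullet> u"
      using inner_segment_attained[OF continuous_on_periodic_extension[OF closed C1] le u[unfolded V_def]] .
    obtain y where y: "y \<in> {k * h..Suc k * h}" "c \<bullet> G y = c \<bullet> v"
      using inner_segment_attained[OF continuous_on_periodic_extension[OF closed C1] le v[unfolded V_def]] .
    have "G x = G y"
      using cone_inner_neq[OF c near_j[OF x(1)] near_k[OF y(1)]] x(2) y(2) eq
      by (auto simp: inner_diff_right)
    then obtain m :: int where m: "x = y + of_int m * L" using G_eq_iff by blast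
    have "Suc j * h \<le> k * h" "Suc k * h \<le> N * h"
      using False jk h_pos by (intro mult_right_mono; simp)+
    then have bounds: "0 \<le> x" "x \<le> Suc j * h" "Suc j * h \<le> k * h" "k * h \<le> y" "y \<le> Suc k * h" "Suc k * h \<le> L"
      using x(1) y(1) h_pos N_h by (auto intro: order_trans[of 0 "j * h"])
    \<comment> \<open>From \<open>0 \<le> x \<le> y \<le> L\<close> the difference
      \<open>x - y\<close> lies between \<open>- L\<close> and 0. So distinct arcs meet only at a
      common division point (\<open>m = 0\<close>) or where the last arc closes up with the first
      (\<open>m = - 1\<close>).\<close>
    have "- 1 \<le> m" "m \<le> 0"
    proof -
      have "of_int m * L \<le> 0" "- L \<le> of_int m * L" using m bounds by linarith+
      then have "of_int m \<le> (0 :: real)" "- 1 \<le> (of_int m :: real)"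
        using h_pos two_h_less mult_le_cancel_right[of "- 1" L "of_int m"]
        by (auto simp: mult_le_0_iff)
      then show "- 1 \<le> m" "m \<le> 0" by linarith+
    qed
    then consider "m = 0" | "m = - 1" by linarith
    then have ends: "G x \<in> {V j, V (Suc j)} \<and> G y \<in> {V k, V (Suc k)}"
    proof cases
      case 1
      then have "x = y" using m by simp
      then have "x = Suc j * h" "y = k * h" using bounds by linarith+
      then show ?thesis by (simp_all add: V_def)
    next
      case 2
      then have "x = y - L" using m by simp
      then have "x = 0" "y = Suc k * h" using bounds by linarith+
      moreover from this have "j * h = x" using x(1) h_pos by (auto simp: mult_le_0_iff)
      ultimately show ?thesis by (auto simp: V_def)
    qed
    \<comment> \<open>The meeting point is an end of both edges, so injectivity of \<open>c\<close>
      on each edge identifies it with \<open>u\<close> and with \<open>v\<close>.\<close>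
    have "G x = u"
      by (rule inner_inj_on_segment[OF edge[OF near_j] _ u x(2)]) (use ends in auto)
    moreover have "G y = v"
      by (rule inner_inj_on_segment[OF edge[OF near_k] _ v y(2)]) (use ends in auto)
    ultimately show False using \<open>G x = G y\<close> \<open>u \<noteq> v\<close> by simp
  qed
qed

text \<open>For a tangent \<open>c\<close> at the middle vertex, \<open>c \<bullet> G x\<close> is
  injective, hence monotone, along the two adjacent arcs. Both edge vectors thus have inner products
  with \<open>c\<close> of the same strict sign, and no admissible combination cancels.\<close>

lemma corner_nonzero:
  assumes "0 \<le> \<alpha>" "0 \<le> \<beta>" "0 < \<alpha> + \<beta>"
  shows "\<alpha> *\<^sub>R (V (Suc i) - V i) + \<beta> *\<^sub>R (V (Suc (Suc i)) - V (Suc i)) \<noteq> 0"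
proof
  assume zero: "\<alpha> *\<^sub>R (V (Suc i) - V i) + \<beta> *\<^sub>R (V (Suc (Suc i)) - V (Suc i)) = 0"
  define s where "s = Suc i * h"
  define c where "c = left_tangent \<gamma> L s"
  have "c = 1 *\<^sub>R left_tangent \<gamma> L s + 0 *\<^sub>R right_tangent \<gamma> L s" by (simp add: c_def)
  then have c: "c \<in> tangent_cone \<gamma> L s" unfolding tangent_cone_def by fastforce
  let ?f = "\<lambda>x. c \<bullet> G x"
  have V: "V i = G (s - h)" "V (Suc i) = G s" "V (Suc (Suc i)) = G (s + h)"
    by (simp_all add: V_def s_def algebra_simps)
  have near: "dist (G s) (G x) \<le> r" if "x \<in> {s - h..s + h}" for x
  proof -
    have "dist (G s) (G x) \<le> \<eta>" using that by (intro mesh_h) (auto simp: abs_le_iff)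
    then show ?thesis using \<eta> zero_le_dist[of "G s" "G x"] by linarith
  qed
  have "inj_on ?f {s - h..s + h}"
  proof (rule inj_onI, rule ccontr)
    fix x y
    assume xy: "x \<in> {s - h..s + h}" "y \<in> {s - h..s + h}" "?f x = ?f y" "x \<noteq> y"
    \<comment> \<open>The two parameters differ by at most \<open>2 * h\<close>, which is less than
      one period.\<close>
    then have "G x \<noteq> G y" using two_h_less by (intro G_neq) auto
    then show False
      using cone_inner_neq[OF c near near, of x y] xy by (simp add: inner_diff_right)
  qed
  then have mono: "?f (s - h) < ?f s \<and> ?f s < ?f (s + h) \<or> ?f (s + h) < ?f s \<and> ?f s < ?f (s - h)"
    using h_pos continuous_on_periodic_extension[OF closed C1]
    by (intro continuous_inj_imp_mono) (auto intro!: continuous_intros)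
  define p q where "p = c \<bullet> (V (Suc i) - V i)" and "q = c \<bullet> (V (Suc (Suc i)) - V (Suc i))"
  have "0 < p \<and> 0 < q \<or> p < 0 \<and> q < 0"
    using mono by (auto simp: p_def q_def V inner_diff_right)
  moreover have "\<alpha> * p + \<beta> * q = 0"
    using arg_cong[OF zero, of "(\<bullet>) c"] by (simp add: p_def q_def inner_add_right)
  moreover have "0 < \<alpha> \<or> 0 < \<beta>" using assms by linarith
  ultimately show False
    using assms(1,2) mult_pos_pos mult_nonneg_nonneg mult_pos_neg mult_nonneg_nonpos
    by (smt (verit))
qed

lemma TCGL_P: "TCGL P (T N) R"
  unfolding TCGL_def TCGL_at_def
proof (intro ballI impI)
  fix t w u v
  assume t: "t \<in> {0..T N}" and w: "w \<in> tangent_cone P (T N) t"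
    and u: "u \<in> P ` {0..T N} \<inter> cball (P t) R" and v: "v \<in> P ` {0..T N} \<inter> cball (P t) R"
    and "u \<noteq> v"
  obtain i \<alpha> \<beta> where i: "i < N" "P t \<in> closed_segment (V i) (V (Suc i))"
    "0 \<le> \<alpha>" "0 \<le> \<beta>" "0 < \<alpha> + \<beta>"
    "w = \<alpha> *\<^sub>R (V (Suc i) - V i) + \<beta> *\<^sub>R (V (Suc (Suc i)) - V (Suc i))"
    using tangent_cone_P[OF t w] .
  have "w \<noteq> 0" using corner_nonzero[OF i(3-5)] i(6) by simp
  define n where "n = perp w"
  define p q where "p = n \<bullet> (V (Suc i) - V i)" and "q = n \<bullet> (V (Suc (Suc i)) - V (Suc i))"
  have "\<alpha> * p + \<beta> * q = n \<bullet> w" by (simp add: i(6) p_def q_def inner_add_right)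
  also have "\<dots> = 0" by (simp add: n_def inner_perp)
  finally have pq: "\<alpha> * p + \<beta> * q = 0" .
  \<comment> \<open>If \<open>p\<close> and \<open>q\<close> had the same strict sign,
    \<open>\<alpha> * p + \<beta> * q\<close> could not vanish. Hence \<open>perp w\<close>
    satisfies the sign condition of \<open>tangent_cone_orthogonal\<close> on the two arcs at the
    vertex.\<close>
  have "p * q \<le> 0"
  proof (rule ccontr)
    assume "\<not> p * q \<le> 0"
    then have "0 < p \<and> 0 < q \<or> p < 0 \<and> q < 0" by (auto simp: not_le zero_less_mult_iff)
    moreover have "0 < \<alpha> \<or> 0 < \<beta>" using i(5) by linarith
    ultimately show False
      using pq i(3,4) mult_pos_pos mult_nonneg_nonneg mult_pos_neg mult_nonneg_nonpos
      by (smt (verit))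
  qed
  then obtain s c where s: "s \<in> {i * h<..<Suc (Suc i) * h}" "c \<in> tangent_cone \<gamma> L s" "n \<bullet> c = 0"
    using tangent_cone_orthogonal[OF closed C1, of "i * h" "Suc i * h" "Suc (Suc i) * h" n] h_pos
    by (auto simp: p_def q_def V_def)
  \<comment> \<open>In the plane, \<open>c\<close> and the nonzero \<open>w\<close> are both
    orthogonal to \<open>n\<close>, hence parallel.\<close>
  obtain k where k: "c = k *\<^sub>R w"
    using perp_orthogonal_imp_parallel[OF \<open>w \<noteq> 0\<close>] s(3) unfolding n_def by blast
  \<comment> \<open>\<open>Suc i * h\<close> is the midpoint of the interval containing
    \<open>s\<close>, and \<open>V (Suc i)\<close> is also an end of the edge through
    \<open>P t\<close>.\<close>
  have "dist (G s) (V (Suc i)) \<le> \<eta>"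
    unfolding V_def using s(1) by (intro mesh_h) (auto simp: algebra_simps abs_le_iff)
  moreover have "dist (V (Suc i)) (P t) \<le> \<eta>"
    using arc_near_segment[of "Suc i * h" i "P t"] i(2) h_pos by (simp add: V_def)
  ultimately have base: "dist (G s) (P t) \<le> 2 * \<eta>"
    using dist_triangle[of "G s" "P t" "V (Suc i)"] by linarith
  \<comment> \<open>Via \<open>P t\<close> and \<open>z\<close> the distance is at most
    \<open>2 * \<eta> + R + \<eta>\<close>; one polygon point in the small disk brings its whole arc
    into the large one.\<close>
  have near: "dist (G s) (G x) \<le> r"
    if "x \<in> {j * h..Suc j * h}" "z \<in> closed_segment (V j) (V (Suc j))" "z \<in> cball (P t) R"
    for x z j
    using base arc_near_segment[OF that(1,2)] that(3) R dist_triangle[of "G s" z "P t"]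
      dist_triangle[of "G s" "G x" z] by (simp add: dist_commute)
  obtain j l where j: "j < N" "u \<in> closed_segment (V j) (V (Suc j))"
    and l: "l < N" "v \<in> closed_segment (V l) (V (Suc l))"
    using image_P_subset u v by blast
  have "c \<bullet> u \<noteq> c \<bullet> v"
  proof (cases "j \<le> l")
    case True
    show ?thesis
      by (rule cone_inner_segments_neq[OF s(2) True l(1) j(2) l(2)])
        (use near j(2) l(2) u v \<open>u \<noteq> v\<close> in auto)
  next
    case False
    have "c \<bullet> v \<noteq> c \<bullet> u"
      by (rule cone_inner_segments_neq[OF s(2) _ j(1) l(2) j(2)])
        (use False near j(2) l(2) u v \<open>u \<noteq> v\<close> in auto)
    then show ?thesis by simp
  qed
  \<comment> \<open>Since \<open>c = k w\<close>, a vanishing inner product with \<open>w\<close>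
    would make the values of \<open>c\<close> at \<open>u\<close> and \<open>v\<close>
    equal.\<close>
  then show "w \<bullet> (u - v) \<noteq> 0" by (auto simp: k inner_diff_right)
qed

lemma curve_near_P:
  assumes "x \<in> \<gamma> ` {0..L}"
  shows "\<exists>y\<in>P ` {0..T N}. dist x y \<le> \<eta>"
proof -
  obtain a where a: "x = \<gamma> a" "a \<in> {0..L}" using assms by blast
  \<comment> \<open>The last division point not after \<open>a\<close>; for \<open>a = L\<close> it
    is \<open>N\<close>, still a vertex index of the polygon.\<close>
  define i where "i = nat \<lfloor>a / h\<rfloor>"
  have fl: "of_nat i = (of_int \<lfloor>a / h\<rfloor> :: real)" using a(2) h_pos by (simp add: i_def)
  have "a / h \<le> N" using a(2) N_h h_pos by (simp add: field_simps)
  then have "i \<le> N" unfolding i_def by linarith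
  moreover have "\<bar>a - i * h\<bar> \<le> h"
  proof -
    have "i * h \<le> a" "a < (i + 1) * h"
      using floor_divide_lower[OF h_pos, of a] floor_divide_upper[OF h_pos, of a] fl
      by (auto simp: add.commute)
    then show ?thesis by (simp add: algebra_simps)
  qed
  then have "dist x (V i) \<le> \<eta>"
    using mesh_h[of a "i * h"] a periodic_extension_eq[OF closed, of a] by (simp add: V_def)
  ultimately show ?thesis using vertex_in_image by blast
qed

end

section \<open>Choice of the mesh and conclusion\<close>

theorem lemma4p3p1:
  fixes \<Omega> :: "(real ^ 2) set" and \<gamma> :: "real \<Rightarrow> real ^ 2" and L r \<epsilon> :: real
  assumes "compact \<Omega>"
    and "boundary_parameterization \<Omega> \<gamma> L"
    and "TCGL \<gamma> L r"
    and "0 < \<epsilon>" and "\<epsilon> < r"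
  shows "\<exists>(P :: real \<Rightarrow> real ^ 2) M.
           closed_curve P M \<and> polygonal P M \<and> arclength_parameterized P M \<and>
           TCGL P M (r - \<epsilon>) \<and>
           (\<forall>x\<in>frontier \<Omega>. \<exists>y\<in>P ` {0..M}. dist x y \<le> \<epsilon> / 6)"
proof -
  have simple: "simple_closed_curve \<gamma> L" and C1: "piecewise_C1 \<gamma> L"
    and frontier: "\<gamma> ` {0..L} = frontier \<Omega>"
    using assms(2) by (auto simp: boundary_parameterization_def)
  then have closed: "closed_curve \<gamma> L" by (simp add: simple_closed_curve_def)
  obtain \<delta> where \<delta>: "0 < \<delta>" "\<And>x y. \<bar>x - y\<bar> < \<delta> \<Longrightarrow>
    dist (periodic_extension \<gamma> L x) (periodic_extension \<gamma> L y) < \<epsilon> / 6"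
    using uniformly_continuous_periodic_extension[OF closed C1, of "\<epsilon> / 6"] assms(4) by auto
  \<comment> \<open>Enough samples for the mesh width \<open>L / N\<close> to fall below
    \<open>\<delta>\<close>, and more than three.\<close>
  obtain N :: nat where N: "max 3 (L / \<delta>) < real N" using reals_Archimedean2 by blast
  then have "L / N < \<delta>" using \<delta>(1) by (simp add: field_simps)
  \<comment> \<open>With \<open>\<eta> = \<epsilon> / 6\<close> the radius budget is
    \<open>r - \<epsilon> + \<epsilon> / 2 \<le> r\<close>, and
    \<open>2 * \<eta> = \<epsilon> / 3\<close> is below \<open>r\<close>.\<close>
  interpret TCGL_sampling \<gamma> L r "r - \<epsilon>" "\<epsilon> / 6" N
  proof
    show "dist (periodic_extension \<gamma> L x) (periodic_extension \<gamma> L y) \<le> \<epsilon> / 6"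
      if "\<bar>x - y\<bar> \<le> L / N" for x y
      using \<delta>(2)[of x y] that \<open>L / N < \<delta>\<close> by simp
  qed (use simple C1 assms N in auto)
  show ?thesis
    using closed_curve_P polygonal_P arclength_parameterized_P TCGL_P curve_near_P frontier by metis
qed

end
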